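(* Let $\{x_1,\dots,x_n\}\subset\mathbb{R}^{d+1}$ be a set of points, $\lambda\in\mathbb{R}^n$, $\tau=\frac rs\in\mathbb{Q}$ with $r>s\in\mathbb{N}$ and $\gcd(r,s)=1$, and let $\|\cdot\|_\tau$ be the $\ell_\tau$-norm in $\mathbb{R}^d$. Let $\nu$ be such that $\frac1\tau+\frac1\nu=1$. Then the fitting hyperplane problem $$\min_{\beta\in\mathbb{R}^{d+1}}\ \sum_{i=1}^n\lambda_i\,\varepsilon_{(i)}(\beta)^p,\qquad \varepsilon_{x_i}(\beta)=\min_{y\in\mathcal H(\beta)}\|(x_i)_{-0}-y\|_\tau,$$ is equivalent to the following mathematical programming problem in the variables $\beta\in\mathbb{R}^{d+1}$, $\varepsilon\in\mathbb{R}^n$, $z,\theta\in\mathbb{R}^n_+$, $w_{ij}\in\{0,1\}$ ($i,j=1,\dots,n$): $$\begin{aligned} \min\ & \sum_{j=1}^n\lambda_j\theta_j\\ \text{s.t. } & z_i\le\theta_j+M(1-w_{ij}), && i,j=1,\dots,n,\\ & z_i^{s'}\ge\varepsilon_i^{r'}, && i=1,\dots,n,\\ & \textstyle\sum_{i=1}^n w_{ij}=1, && j=1,\dots,n,\\ & \textstyle\sum_{j=1}^n w_{ij}=1, && i=1,\dots,n,\\ & \theta_j\ge\theta_{j-1}, && j=2,\dots,n,\\ & \varepsilon_i\ge\beta^tx_i,\quad \varepsilon_i\ge-\beta^tx_i, && i=1,\dots,n,\\ & \|\beta_{-0}\|_\nu=1. \end{aligned}$$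
   Context: Vectors in $\mathbb{R}^{d+1}$ are indexed $0,1,\dots,d$; for $y\in\mathbb{R}^{d+1}$, $y_{-0}=(y_1,\dots,y_d)$. The points $x_i\in\mathbb{R}^{d+1}$ have $0$-th coordinate equal to $1$, the actual point in $\mathbb{R}^d$ being $(x_i)_{-0}$. For $\beta\in\mathbb{R}^{d+1}$, $\mathcal H(\beta)=\{y\in\mathbb{R}^d:(1,y^t)\beta=0\}$. $\varepsilon_{(1)}(\beta)\le\dots\le\varepsilon_{(n)}(\beta)$ are the residuals $\varepsilon_{x_1}(\beta),\dots,\varepsilon_{x_n}(\beta)$ sorted in nondecreasing order. The exponent of the aggregation criterion is $p=\frac{r'}{s'}\in\mathbb{Q}$ with $r',s'$ positive integers. $M$ is a sufficiently large ("big-M") constant.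
   Formalization: The weights λ_i are assumed nonnegative (for λ=(1,-1), n=2, p=1 the program is unbounded below while the fitting problem is not), and the fitting problem ranges over β with β_{-0}≠0, so that H(β) is a hyperplane. *)

theory Defs
  imports "HOL-Analysis.Analysis"
begin

(* R^(d+1) is modelled as real \<times> (real ^ 'd): fst is the 0-th coordinate y_0 and
   snd is y_{-0} = (y_1, ..., y_d).  The inner product of the product space is
   the usual one on R^(d+1). *)

definition lp_norm :: "real \<Rightarrow> real ^ 'd \<Rightarrow> real" where
  "lp_norm q v = (\<Sum>i\<in>UNIV. \<bar>v $ i\<bar> powr q) powr (1 / q)"

definition hyperplane :: "real \<times> (real ^ 'd) \<Rightarrow> (real ^ 'd) set" where
  "hyperplane \<beta> = {y. (1, y) \<bullet> \<beta> = 0}"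

(* LEAST is the minimum; it is unspecified when no minimum exists, in particular
   when the hyperplane is empty (snd \<beta> = 0 and fst \<beta> \<noteq> 0). *)
definition residual :: "real \<Rightarrow> real \<times> (real ^ 'd) \<Rightarrow> real \<times> (real ^ 'd) \<Rightarrow> real" where
  "residual \<tau> \<beta> x = (LEAST m. m \<in> (\<lambda>y. lp_norm \<tau> (snd x - y)) ` hyperplane \<beta>)"

(* Points are x 1, ..., x n, and the order statistics are numbered from 1. *)
definition sorted_residual ::
  "real \<Rightarrow> nat \<Rightarrow> (nat \<Rightarrow> real \<times> (real ^ 'd)) \<Rightarrow> real \<times> (real ^ 'd) \<Rightarrow> nat \<Rightarrow> real" where
  "sorted_residual \<tau> n x \<beta> i = sort (map (\<lambda>k. residual \<tau> \<beta> (x k)) [1..<Suc n]) ! (i - 1)"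

definition fit_objective ::
  "real \<Rightarrow> real \<Rightarrow> nat \<Rightarrow> (nat \<Rightarrow> real) \<Rightarrow> (nat \<Rightarrow> real \<times> (real ^ 'd)) \<Rightarrow> real \<times> (real ^ 'd) \<Rightarrow> real" where
  "fit_objective \<tau> p n lam x \<beta> = (\<Sum>i=1..n. lam i * sorted_residual \<tau> n x \<beta> i powr p)"

(* The parameters \<beta> for which hyperplane \<beta> is a genuine hyperplane. *)
definition fit_feasible :: "real \<times> (real ^ 'd) \<Rightarrow> bool" where
  "fit_feasible \<beta> \<longleftrightarrow> snd \<beta> \<noteq> 0"

(* (\<beta>, \<epsilon>, z, \<theta>, w).  Vectors in R^n are functions on nat of which only the values
   on {1..n} are constrained or used. *)
type_synonym 'd mip_vars =
  "(real \<times> (real ^ 'd)) \<times> (nat \<Rightarrow> real) \<times> (nat \<Rightarrow> real) \<times> (nat \<Rightarrow> real) \<times> (nat \<Rightarrow> nat \<Rightarrow> real)"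

definition mip_objective :: "nat \<Rightarrow> (nat \<Rightarrow> real) \<Rightarrow> 'd mip_vars \<Rightarrow> real" where
  "mip_objective n lam = (\<lambda>(\<beta>, \<epsilon>, z, \<theta>, w). \<Sum>j=1..n. lam j * \<theta> j)"

definition mip_feasible ::
  "real \<Rightarrow> nat \<Rightarrow> nat \<Rightarrow> nat \<Rightarrow> (nat \<Rightarrow> real \<times> (real ^ 'd)) \<Rightarrow> real \<Rightarrow> 'd mip_vars \<Rightarrow> bool" where
  "mip_feasible \<nu> r' s' n x M = (\<lambda>(\<beta>, \<epsilon>, z, \<theta>, w).
     (\<forall>i\<in>{1..n}. z i \<ge> 0 \<and> \<theta> i \<ge> 0) \<and>
     (\<forall>i\<in>{1..n}. \<forall>j\<in>{1..n}. w i j \<in> {0, 1}) \<and>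
     (\<forall>i\<in>{1..n}. \<forall>j\<in>{1..n}. z i \<le> \<theta> j + M * (1 - w i j)) \<and>
     (\<forall>i\<in>{1..n}. z i ^ s' \<ge> \<epsilon> i ^ r') \<and>
     (\<forall>j\<in>{1..n}. (\<Sum>i=1..n. w i j) = 1) \<and>
     (\<forall>i\<in>{1..n}. (\<Sum>j=1..n. w i j) = 1) \<and>
     (\<forall>j\<in>{2..n}. \<theta> j \<ge> \<theta> (j - 1)) \<and>
     (\<forall>i\<in>{1..n}. \<epsilon> i \<ge> \<beta> \<bullet> x i \<and> \<epsilon> i \<ge> - (\<beta> \<bullet> x i)) \<and>
     lp_norm \<nu> (snd \<beta>) = 1)"

end

theory Submission
  imports Defs "HOL-Combinatorics.List_Permutation"
begin

text \<open>By Hoelder's inequality and its equality case, the residual of \<open>x\<close> is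
  \<open>\<bar>\<beta> \<bullet> x\<bar> / lp_norm \<nu> (snd \<beta>)\<close>, so the fitting objective is invariant under scaling of \<open>\<beta>\<close> and may be
  restricted to normalised \<open>\<beta>\<close>. In a feasible point of the program \<open>w\<close> is a permutation matrix, so \<open>k\<close>
  of the \<open>z i\<close> lie below \<open>\<theta> k\<close>; hence the objective dominates the fitting objective at the same \<open>\<beta>\<close>,
  with equality reached when \<open>M\<close> exceeds the powers of the residuals. A positive weight makes the
  residuals of all normalised minimisers uniformly bounded, which gives both a uniform \<open>M\<close> and, by
  compactness, the existence of minimisers.\<close>

section \<open>Hoelder's inequality and the residual\<close>

lemma lp_norm_nonneg: "lp_norm q v \<ge> 0"
  by (simp add: lp_norm_def)

lemma sum_powr_pos:
  fixes v :: "real ^ 'd"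
  assumes "v \<noteq> 0"
  shows "(\<Sum>i\<in>UNIV. \<bar>v $ i\<bar> powr q) > 0"
proof -
  obtain k where "v $ k \<noteq> 0"
    using assms by (auto simp: vec_eq_iff)
  then show ?thesis
    by (intro sum_pos2[where i = k]) auto
qed

lemma lp_norm_pos: "v \<noteq> 0 \<Longrightarrow> lp_norm q v > 0"
  using sum_powr_pos[of v q] by (simp add: lp_norm_def)

lemma lp_norm_zero [simp]: "lp_norm q 0 = 0"
  by (simp add: lp_norm_def)

lemma lp_norm_scaleR:
  assumes "q > 0"
  shows "lp_norm q (c *\<^sub>R v) = \<bar>c\<bar> * lp_norm q v"
proof -
  have "(\<Sum>i\<in>UNIV. \<bar>(c *\<^sub>R v) $ i\<bar> powr q) = \<bar>c\<bar> powr q * (\<Sum>i\<in>UNIV. \<bar>v $ i\<bar> powr q)"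
    by (simp add: abs_mult powr_mult sum_distrib_left)
  then show ?thesis
    using assms by (simp add: lp_norm_def powr_mult powr_powr sum_nonneg)
qed

lemma sum_powr_lp_norm:
  assumes "q > 0"
  shows "(\<Sum>i\<in>UNIV. \<bar>v $ i\<bar> powr q) = lp_norm q v powr q"
  using assms by (simp add: lp_norm_def powr_powr sum_nonneg)

text \<open>A positive exponent keeps \<open>powr\<close> continuous at base 0, so vanishing
  coordinates do no harm.\<close>

lemma continuous_on_lp_norm:
  assumes "q > 0"
  shows "continuous_on S (lp_norm q)"
  unfolding lp_norm_def
  by (intro continuous_on_powr' continuous_on_sum continuous_intros ballI conjI impI sum_nonneg)
    (use assms in auto)

text \<open>Each coordinate is at most 1 in absolute value, so the l1 norm is at most the dimension.
  The crude constant suffices, since only boundedness matters for compactness.\<close>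

lemma norm_le_of_lp_norm_le_1:
  fixes v :: "real ^ 'd"
  assumes "q > 0" "lp_norm q v \<le> 1"
  shows "norm v \<le> real CARD('d)"
proof -
  have "\<bar>v $ i\<bar> \<le> 1" for i
  proof -
    have "\<bar>v $ i\<bar> powr q \<le> (\<Sum>i\<in>UNIV. \<bar>v $ i\<bar> powr q)"
      by (rule member_le_sum) auto
    also have "\<dots> \<le> 1 powr q"
      unfolding sum_powr_lp_norm[OF assms(1)]
      using assms lp_norm_nonneg by (intro powr_mono2) auto
    finally show ?thesis
      using powr_less_mono2[OF assms(1), of 1 "\<bar>v $ i\<bar>"] by (meson linorder_not_le zero_le_one)
  qed
  then have "(\<Sum>i\<in>UNIV. \<bar>v $ i\<bar>) \<le> (\<Sum>i\<in>(UNIV :: 'd set). 1)"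
    by (intro sum_mono)
  then show ?thesis
    using norm_le_l1_cart[of v] by simp
qed

text \<open>After division of both vectors by their norms, Young's inequality in each coordinate
  sums to 1/\<tau> + 1/\<nu> = 1. Zero vectors are split off because of this division.\<close>

lemma lp_norm_Hoelder:
  fixes u v :: "real ^ 'd"
  assumes "\<tau> > 1" "\<nu> > 1" "1 / \<tau> + 1 / \<nu> = 1"
  shows "\<bar>u \<bullet> v\<bar> \<le> lp_norm \<nu> u * lp_norm \<tau> v"
proof (cases "u = 0 \<or> v = 0")
  case True
  then show ?thesis by auto
next
  case False
  define a where "a = lp_norm \<nu> u"
  define b where "b = lp_norm \<tau> v"
  have ab: "a > 0" "b > 0"
    using False by (auto simp: a_def b_def lp_norm_pos)
  have "\<bar>u \<bullet> v\<bar> / (a * b) \<le> (\<Sum>i\<in>UNIV. \<bar>u $ i\<bar> * \<bar>v $ i\<bar>) / (a * b)"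
    unfolding inner_vec_def using ab
    by (intro divide_right_mono order_trans[OF sum_abs]) (auto simp: abs_mult)
  also have "\<dots> = (\<Sum>i\<in>UNIV. (\<bar>v $ i\<bar> / b) * (\<bar>u $ i\<bar> / a))"
    by (simp add: sum_divide_distrib mult.commute)
  also have "\<dots> \<le> (\<Sum>i\<in>UNIV. (\<bar>v $ i\<bar> / b) powr \<tau> / \<tau> + (\<bar>u $ i\<bar> / a) powr \<nu> / \<nu>)"
    using assms ab by (intro sum_mono Youngs_inequality) auto
  also have "\<dots> = (\<Sum>i\<in>UNIV. \<bar>v $ i\<bar> powr \<tau>) / b powr \<tau> / \<tau> + (\<Sum>i\<in>UNIV. \<bar>u $ i\<bar> powr \<nu>) / a powr \<nu> / \<nu>"
    using ab by (simp add: sum.distrib sum_divide_distrib powr_divide)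
  also have "\<dots> = 1"
    using assms ab by (simp add: sum_powr_lp_norm a_def b_def)
  finally show ?thesis
    using ab by (simp add: a_def b_def field_simps)
qed

text \<open>Equality in Hoelder needs |v_i|^\<tau> proportional to |u_i|^\<nu>, with the signs of u.
  Scaling to inner product 1 makes v a shortest displacement that changes the inner product with u
  by one unit.\<close>

lemma lp_norm_Hoelder_sharp:
  fixes u :: "real ^ 'd"
  assumes "\<tau> > 1" "\<nu> > 1" "1 / \<tau> + 1 / \<nu> = 1" "u \<noteq> 0"
  obtains v where "u \<bullet> v = 1" "lp_norm \<tau> v = 1 / lp_norm \<nu> u"
proof
  define S where "S = (\<Sum>i\<in>UNIV. \<bar>u $ i\<bar> powr \<nu>)"
  define v' :: "real ^ 'd" where "v' = (\<chi> i. sgn (u $ i) * \<bar>u $ i\<bar> powr (\<nu> - 1))"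
  have S: "S > 0"
    using assms(4) by (simp add: S_def sum_powr_pos)
  have "u $ i * (v' $ i) = \<bar>u $ i\<bar> powr \<nu>" for i
    using assms powr_mult_base[of "\<bar>u $ i\<bar>" "\<nu> - 1"]
    by (auto simp: v'_def sgn_if)
  then have inn: "u \<bullet> v' = S"
    by (simp add: inner_vec_def S_def)
  have exps: "(\<nu> - 1) * \<tau> = \<nu>"
    using assms by (simp add: field_simps)
  have "\<bar>v' $ i\<bar> powr \<tau> = \<bar>u $ i\<bar> powr \<nu>" for i
    by (auto simp: v'_def abs_mult abs_sgn_eq powr_powr exps)
  then have nrm: "lp_norm \<tau> v' = S powr (1 / \<tau>)"
    by (simp add: lp_norm_def S_def)
  show "u \<bullet> (v' /\<^sub>R S) = 1"
    using inn S by simp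
  have "lp_norm \<tau> (v' /\<^sub>R S) = S powr (1 / \<tau>) / S"
    using assms S by (simp add: lp_norm_scaleR nrm divide_inverse mult.commute)
  also have "\<dots> = S powr (1 / \<tau> - 1)"
    using S by (simp add: powr_diff)
  also have "1 / \<tau> - 1 = - (1 / \<nu>)"
    using assms by simp
  finally show "lp_norm \<tau> (v' /\<^sub>R S) = 1 / lp_norm \<nu> u"
    by (simp add: powr_minus_divide lp_norm_def S_def)
qed

text \<open>Hoelder bounds the distance to any point of the hyperplane from below. Moving from the
  data point by -(\<beta> \<bullet> x) times the extremal vector lands on the hyperplane and attains
  the bound, so \<open>LEAST\<close> is a genuine minimum.\<close>

lemma residual_eq:
  fixes x \<beta> :: "real \<times> (real ^ 'd)"
  assumes "\<tau> > 1" "\<nu> > 1" "1 / \<tau> + 1 / \<nu> = 1" "snd \<beta> \<noteq> 0" "fst x = 1"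
  shows "residual \<tau> \<beta> x = \<bar>\<beta> \<bullet> x\<bar> / lp_norm \<nu> (snd \<beta>)"
  unfolding residual_def
proof (rule Least_equality)
  have pos: "lp_norm \<nu> (snd \<beta>) > 0"
    using assms by (simp add: lp_norm_pos)
  have inner: "\<beta> \<bullet> x = fst \<beta> + snd \<beta> \<bullet> snd x"
    using assms(5) by (simp add: inner_prod_def)
  obtain v where v: "snd \<beta> \<bullet> v = 1" "lp_norm \<tau> v = 1 / lp_norm \<nu> (snd \<beta>)"
    using lp_norm_Hoelder_sharp assms by metis
  have "snd x - (\<beta> \<bullet> x) *\<^sub>R v \<in> hyperplane \<beta>"
    using v(1) assms(5) by (simp add: hyperplane_def inner_prod_def inner inner_diff_left inner_diff_right inner_commute)
  moreover have "lp_norm \<tau> (snd x - (snd x - (\<beta> \<bullet> x) *\<^sub>R v)) = \<bar>\<beta> \<bullet> x\<bar> / lp_norm \<nu> (snd \<beta>)"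
    using assms(1) v(2) by (simp add: lp_norm_scaleR)
  ultimately show "\<bar>\<beta> \<bullet> x\<bar> / lp_norm \<nu> (snd \<beta>) \<in> (\<lambda>y. lp_norm \<tau> (snd x - y)) ` hyperplane \<beta>"
    by (metis imageI)
  fix m assume "m \<in> (\<lambda>y. lp_norm \<tau> (snd x - y)) ` hyperplane \<beta>"
  then obtain y where y: "(1, y) \<bullet> \<beta> = 0" "m = lp_norm \<tau> (snd x - y)"
    by (auto simp: hyperplane_def)
  have "\<beta> \<bullet> x = snd \<beta> \<bullet> (snd x - y)"
    using y(1) assms(5) by (simp add: inner_prod_def inner_diff_right inner_commute)
  then have "\<bar>\<beta> \<bullet> x\<bar> \<le> lp_norm \<nu> (snd \<beta>) * m"
    using lp_norm_Hoelder[OF assms(1-3)] y(2) by simp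
  then show "\<bar>\<beta> \<bullet> x\<bar> / lp_norm \<nu> (snd \<beta>) \<le> m"
    using pos by (simp add: divide_le_eq mult.commute)
qed

section \<open>Order statistics\<close>

definition order_stat :: "nat \<Rightarrow> (nat \<Rightarrow> real) \<Rightarrow> nat \<Rightarrow> real" where
  "order_stat n e k = sort (map e [1..<Suc n]) ! (k - 1)"

lemma order_stat_cong:
  "(\<And>i. i \<in> {1..n} \<Longrightarrow> e i = e' i) \<Longrightarrow> order_stat n e k = order_stat n e' k"
  unfolding order_stat_def by (intro arg_cong2[where f = nth] arg_cong[where f = sort]) auto

lemma order_stat_mono:
  "1 \<le> j \<Longrightarrow> j \<le> k \<Longrightarrow> k \<le> n \<Longrightarrow> order_stat n e j \<le> order_stat n e k"
  unfolding order_stat_def by (rule sorted_nth_mono) auto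

text \<open>The entries at most \<open>t\<close> form an initial segment of the sorted list.
  Inequalities for order statistics thereby become comparisons of cardinalities.\<close>

lemma order_stat_le_iff:
  assumes "k \<in> {1..n}"
  shows "order_stat n e k \<le> t \<longleftrightarrow> k \<le> card {i \<in> {1..n}. e i \<le> t}"
proof -
  define ys where "ys = sort (map e [1..<Suc n])"
  define C where "C = {j. j < length ys \<and> ys ! j \<le> t}"
  have len: "length ys = n" and srt: "sorted ys"
    by (auto simp: ys_def)
  \<comment> \<open>Sorting only permutes the list, so the entries at most \<open>t\<close> may be
    counted over the original indices.\<close>
  have "mset (filter (\<lambda>y. y \<le> t) ys) = mset (filter (\<lambda>y. y \<le> t) (map e [1..<Suc n]))"
    by (simp add: ys_def)
  then have "length (filter (\<lambda>y. y \<le> t) ys) = length (filter (\<lambda>i. e i \<le> t) [1..<Suc n])"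
    unfolding filter_map length_map o_def by (metis length_map mset_eq_length)
  also have "\<dots> = card (set (filter (\<lambda>i. e i \<le> t) [1..<Suc n]))"
    by (intro distinct_card[symmetric]) simp
  also have "set (filter (\<lambda>i. e i \<le> t) [1..<Suc n]) = {i \<in> {1..n}. e i \<le> t}"
    by auto
  finally have card: "card {i \<in> {1..n}. e i \<le> t} = card C"
    by (simp add: length_filter_conv_card C_def)
  show ?thesis
  proof
    assume "order_stat n e k \<le> t"
    then have "ys ! (k - 1) \<le> t"
      by (simp add: order_stat_def ys_def)
    moreover have "ys ! j \<le> ys ! (k - 1)" if "j < k" for j
      using that assms len srt by (intro sorted_nth_mono) auto
    ultimately have "{..<k} \<subseteq> C"
      using assms len by (force simp: C_def)
    then have "card {..<k} \<le> card C"
      by (intro card_mono) (auto simp: C_def)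
    then show "k \<le> card {i \<in> {1..n}. e i \<le> t}"
      using card by simp
  next
    assume k: "k \<le> card {i \<in> {1..n}. e i \<le> t}"
    show "order_stat n e k \<le> t"
    proof (rule ccontr)
      assume "\<not> order_stat n e k \<le> t"
      then have "ys ! (k - 1) > t"
        by (simp add: order_stat_def ys_def)
      \<comment> \<open>\<open>k - 1\<close> is the 0-based position of the k-th order statistic. If
        that entry exceeds \<open>t\<close>, so do all later ones, which leaves at most
        \<open>k - 1\<close> positions in \<open>C\<close>.\<close>
      moreover have "ys ! (k - 1) \<le> ys ! j" if "j \<ge> k - 1" "j < n" for j
        using that len srt by (intro sorted_nth_mono) auto
      ultimately have "C \<subseteq> {..<k - 1}"
        using len by (force simp: C_def not_less[symmetric])
      then have "card C \<le> k - 1"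
        using card_mono[of "{..<k - 1}" C] by simp
      then show False
        using k assms unfolding card by (simp, linarith)
    qed
  qed
qed

text \<open>At the threshold \<open>order_stat n e' k + \<delta>\<close> at least \<open>k\<close>
  of the values \<open>e i\<close> qualify. Used in both directions, this makes order statistics
  1-Lipschitz for the sup norm, hence continuous.\<close>

lemma order_stat_le_shift:
  assumes "k \<in> {1..n}" "\<And>i. i \<in> {1..n} \<Longrightarrow> e i \<le> e' i + \<delta>"
  shows "order_stat n e k \<le> order_stat n e' k + \<delta>"
proof -
  have "k \<le> card {i \<in> {1..n}. e' i \<le> order_stat n e' k}"
    using order_stat_le_iff[OF assms(1)] by blast
  also have "\<dots> \<le> card {i \<in> {1..n}. e i \<le> order_stat n e' k + \<delta>}"
    using assms(2) by (intro card_mono) force+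
  finally show ?thesis
    using assms(1) by (simp add: order_stat_le_iff)
qed

lemma tendsto_order_stat:
  assumes k: "k \<in> {1..n}" and e: "\<And>i. i \<in> {1..n} \<Longrightarrow> ((\<lambda>b. e b i) \<longlongrightarrow> l i) F"
  shows "((\<lambda>b. order_stat n (e b) k) \<longlongrightarrow> order_stat n l k) F"
proof (rule tendstoI)
  fix \<delta> :: real assume "\<delta> > 0"
  then have "\<forall>\<^sub>F b in F. \<forall>i\<in>{1..n}. dist (e b i) (l i) < \<delta> / 2"
    by (intro eventually_ball_finite ballI tendstoD e) auto
  then show "\<forall>\<^sub>F b in F. dist (order_stat n (e b) k) (order_stat n l k) < \<delta>"
  proof eventually_elim
    case (elim b)
    have "order_stat n (e b) k \<le> order_stat n l k + \<delta> / 2"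
      using elim by (intro order_stat_le_shift k) (fastforce simp: dist_real_def abs_real_def split: if_splits)
    moreover have "order_stat n l k \<le> order_stat n (e b) k + \<delta> / 2"
      using elim by (intro order_stat_le_shift k) (fastforce simp: dist_real_def abs_real_def split: if_splits)
    ultimately show ?case
      using \<open>\<delta> > 0\<close> unfolding dist_real_def by linarith
  qed
qed

text \<open>Sorting permutes 0-based list positions; conjugation by the shift gives 1-based ranks.
  The rank map, with ties broken, later supplies the assignment matrix \<open>w\<close>.\<close>

lemma order_stat_permutation:
  obtains \<sigma> where "bij_betw \<sigma> {1..n} {1..n}" "\<And>i. i \<in> {1..n} \<Longrightarrow> order_stat n e (\<sigma> i) = e i"
proof -
  let ?xs = "map e [1..<Suc n]"
  obtain f where f: "bij_betw f {..<n} {..<n}" "\<And>i. i < n \<Longrightarrow> ?xs ! i = sort ?xs ! f i"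
    using permutation_Ex_bij[of ?xs "sort ?xs"] by (auto simp del: upt_Suc)
  have pred: "bij_betw (\<lambda>i. i - 1) {1..n} {..<n}"
    by (rule bij_betw_byWitness[where f' = Suc]) auto
  have suc: "bij_betw Suc {..<n} {1..n}"
    by (rule bij_betw_byWitness[where f' = "\<lambda>i. i - 1"]) auto
  show thesis
  proof
    show "bij_betw (Suc \<circ> (f \<circ> (\<lambda>i. i - 1))) {1..n} {1..n}"
      by (rule bij_betw_trans[OF bij_betw_trans[OF pred f(1)] suc])
    show "order_stat n e ((Suc \<circ> (f \<circ> (\<lambda>i. i - 1))) i) = e i" if "i \<in> {1..n}" for i
      using f(2)[of "i - 1"] that by (auto simp: order_stat_def nth_map simp del: upt_Suc)
  qed
qed

lemma order_stat_attained:
  assumes "k \<in> {1..n}"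
  obtains i where "i \<in> {1..n}" "order_stat n e k = e i"
proof -
  obtain \<sigma> where "bij_betw \<sigma> {1..n} {1..n}" "\<And>i. i \<in> {1..n} \<Longrightarrow> order_stat n e (\<sigma> i) = e i"
    using order_stat_permutation[of n e] by metis
  then show ?thesis
    using that assms unfolding bij_betw_def by (metis imageE)
qed

lemma order_stat_nonneg:
  assumes "k \<in> {1..n}" "\<And>i. i \<in> {1..n} \<Longrightarrow> e i \<ge> 0"
  shows "order_stat n e k \<ge> 0"
  using order_stat_attained[OF assms(1), of e] assms(2) by metis

section \<open>The objective on normalised parameters\<close>

text \<open>On parameters of dual norm 1 this is the fitting objective. It avoids
  \<open>LEAST\<close> and is continuous on the whole space when p > 0.\<close>

definition fit_value ::
  "nat \<Rightarrow> (nat \<Rightarrow> real) \<Rightarrow> real \<Rightarrow> (nat \<Rightarrow> real \<times> (real ^ 'd)) \<Rightarrow> real \<times> (real ^ 'd) \<Rightarrow> real" where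
  "fit_value n lam p x \<beta> = (\<Sum>k=1..n. lam k * order_stat n (\<lambda>i. \<bar>\<beta> \<bullet> x i\<bar>) k powr p)"

lemma fit_objective_eq_fit_value:
  fixes \<beta> :: "real \<times> (real ^ 'd)"
  assumes "\<tau> > 1" "\<nu> > 1" "1 / \<tau> + 1 / \<nu> = 1" "snd \<beta> \<noteq> 0"
    and "\<And>i. i \<in> {1..n} \<Longrightarrow> fst (x i) = 1"
  shows "fit_objective \<tau> p n lam x \<beta> = fit_value n lam p x (\<beta> /\<^sub>R lp_norm \<nu> (snd \<beta>))"
proof -
  have "sorted_residual \<tau> n x \<beta> k = order_stat n (\<lambda>i. \<bar>(\<beta> /\<^sub>R lp_norm \<nu> (snd \<beta>)) \<bullet> x i\<bar>) k" for k
  proof -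
    have "sorted_residual \<tau> n x \<beta> k = order_stat n (\<lambda>i. residual \<tau> \<beta> (x i)) k"
      by (simp add: sorted_residual_def order_stat_def)
    also have "\<dots> = order_stat n (\<lambda>i. \<bar>(\<beta> /\<^sub>R lp_norm \<nu> (snd \<beta>)) \<bullet> x i\<bar>) k"
    proof (rule order_stat_cong)
      fix i assume "i \<in> {1..n}"
      then show "residual \<tau> \<beta> (x i) = \<bar>(\<beta> /\<^sub>R lp_norm \<nu> (snd \<beta>)) \<bullet> x i\<bar>"
        using assms lp_norm_nonneg[of \<nu> "snd \<beta>"]
        by (simp add: residual_eq abs_mult divide_inverse mult.commute)
    qed
    finally show ?thesis .
  qed
  then show ?thesis
    by (simp add: fit_objective_def fit_value_def)
qed

lemma lp_norm_normalise:
  assumes "\<nu> > 0" "v \<noteq> 0"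
  shows "lp_norm \<nu> (v /\<^sub>R lp_norm \<nu> v) = 1"
  using assms lp_norm_pos[of v \<nu>] by (simp add: lp_norm_scaleR)

lemma continuous_on_fit_value:
  assumes "p > 0"
  shows "continuous_on S (fit_value n lam p x)"
  unfolding continuous_on_def fit_value_def
\<comment> \<open>\<open>disjI2\<close> selects the case of a positive exponent and a nonnegative
  base: an order statistic may tend to 0.\<close>
proof (intro ballI tendsto_sum tendsto_mult tendsto_const tendsto_powr' disjI2 conjI)
  fix \<beta> k assume k: "k \<in> {1..n}"
  show "((\<lambda>\<beta>. order_stat n (\<lambda>i. \<bar>\<beta> \<bullet> x i\<bar>) k) \<longlongrightarrow> order_stat n (\<lambda>i. \<bar>\<beta> \<bullet> x i\<bar>) k)
    (at \<beta> within S)"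
    by (intro tendsto_order_stat k tendsto_intros)
  show "\<forall>\<^sub>F \<beta> in at \<beta> within S. 0 \<le> order_stat n (\<lambda>i. \<bar>\<beta> \<bullet> x i\<bar>) k"
    using order_stat_nonneg[OF k] by (intro always_eventually) simp
qed (use assms in auto)

text \<open>A positive weight pins down one residual, and any two residuals of a normalised hyperplane
  differ by at most the distance of their points.\<close>

lemma abs_inner_le_of_fit_value_le:
  assumes conj: "\<tau> > 1" "\<nu> > 1" "1 / \<tau> + 1 / \<nu> = 1" and "p > 0"
    and points: "\<And>i. i \<in> {1..n} \<Longrightarrow> fst (x i) = 1"
    and lam: "\<And>i. i \<in> {1..n} \<Longrightarrow> lam i \<ge> 0"
    and j: "j \<in> {1..n}" "lam j > 0"
    and \<beta>: "lp_norm \<nu> (snd \<beta>) = 1" "fit_value n lam p x \<beta> \<le> C" and i: "i \<in> {1..n}"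
  shows "\<bar>\<beta> \<bullet> x i\<bar> \<le> (C / lam j) powr (1 / p) + (\<Sum>k=1..n. \<Sum>l=1..n. lp_norm \<tau> (snd (x k) - snd (x l)))"
proof -
  let ?o = "order_stat n (\<lambda>i. \<bar>\<beta> \<bullet> x i\<bar>) j"
  have o: "?o \<ge> 0"
    by (rule order_stat_nonneg[OF j(1)]) simp
  have "lam j * ?o powr p \<le> fit_value n lam p x \<beta>"
    unfolding fit_value_def using lam
    by (intro member_le_sum[where f = "\<lambda>k. lam k * order_stat n (\<lambda>i. \<bar>\<beta> \<bullet> x i\<bar>) k powr p"] j) auto
  then have "?o powr p \<le> C / lam j"
    using \<beta>(2) j(2) by (simp add: field_simps)
  then have "(?o powr p) powr (1 / p) \<le> (C / lam j) powr (1 / p)"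
    using \<open>p > 0\<close> by (intro powr_mono2) auto
  then have le: "?o \<le> (C / lam j) powr (1 / p)"
    using o \<open>p > 0\<close> by (simp add: powr_powr)
  obtain l where l: "l \<in> {1..n}" "?o = \<bar>\<beta> \<bullet> x l\<bar>"
    using order_stat_attained[OF j(1)] by metis
  have "\<beta> \<bullet> x i - \<beta> \<bullet> x l = snd \<beta> \<bullet> (snd (x i) - snd (x l))"
    using points[OF i] points[OF l(1)] by (simp add: inner_prod_def inner_diff_right)
  then have "\<bar>\<beta> \<bullet> x i - \<beta> \<bullet> x l\<bar> \<le> lp_norm \<tau> (snd (x i) - snd (x l))"
    using lp_norm_Hoelder[OF conj, of "snd \<beta>" "snd (x i) - snd (x l)"] \<beta>(1) by simp
  \<comment> \<open>The index \<open>l\<close> depends on \<beta>; summing over all pairs yields a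
    bound independent of \<beta> and \<open>i\<close>.\<close>
  also have "\<dots> \<le> (\<Sum>l=1..n. lp_norm \<tau> (snd (x i) - snd (x l)))"
    using l(1) by (intro member_le_sum[where f = "\<lambda>l. lp_norm \<tau> (snd (x i) - snd (x l))"]) (auto simp: lp_norm_nonneg)
  also have "\<dots> \<le> (\<Sum>k=1..n. \<Sum>l=1..n. lp_norm \<tau> (snd (x k) - snd (x l)))"
    using i by (intro member_le_sum[where f = "\<lambda>k. \<Sum>l=1..n. lp_norm \<tau> (snd (x k) - snd (x l))"])
      (auto intro: sum_nonneg simp: lp_norm_nonneg)
  finally show ?thesis
    using le l(2) by linarith
qed

text \<open>Dual norm 1 bounds \<open>snd \<beta>\<close>, and the bound at the single point
  \<open>x j\<close> then controls the intercept \<open>fst \<beta>\<close>.\<close>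

lemma compact_normalised_bounded:
  fixes x :: "nat \<Rightarrow> real \<times> (real ^ 'd)"
  assumes "\<nu> > 0" "j \<in> {1..n}" "fst (x j) = 1"
  shows "compact {\<beta>. lp_norm \<nu> (snd \<beta>) = 1 \<and> (\<forall>i\<in>{1..n}. \<bar>\<beta> \<bullet> x i\<bar> \<le> B)}" (is "compact ?S")
proof (rule compact_eq_bounded_closed[THEN iffD2, OF conjI])
  have "norm \<beta> \<le> B + real CARD('d) * norm (snd (x j)) + real CARD('d)" if "\<beta> \<in> ?S" for \<beta>
  proof -
    have nb: "norm (snd \<beta>) \<le> real CARD('d)"
      using that assms(1) by (intro norm_le_of_lp_norm_le_1) auto
    have "fst \<beta> = \<beta> \<bullet> x j - snd \<beta> \<bullet> snd (x j)"
      using assms(3) by (simp add: inner_prod_def)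
    moreover have "\<bar>\<beta> \<bullet> x j\<bar> \<le> B"
      using that assms(2) by auto
    moreover have "\<bar>snd \<beta> \<bullet> snd (x j)\<bar> \<le> real CARD('d) * norm (snd (x j))"
      using nb by (intro order_trans[OF Cauchy_Schwarz_ineq2] mult_right_mono) auto
    moreover have "norm \<beta> \<le> \<bar>fst \<beta>\<bar> + norm (snd \<beta>)"
      using norm_Pair_le[of "fst \<beta>" "snd \<beta>"] by simp
    ultimately show ?thesis
      using nb by linarith
  qed
  then show "bounded ?S"
    by (rule boundedI)
  have "continuous_on UNIV (\<lambda>\<beta> :: real \<times> (real ^ 'd). lp_norm \<nu> (snd \<beta>))"
    by (rule continuous_on_compose2[OF continuous_on_lp_norm[OF assms(1), of UNIV]])
      (auto intro: continuous_intros)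
  then have "closed ({\<beta>. lp_norm \<nu> (snd \<beta>) = 1} \<inter> (\<Inter>i\<in>{1..n}. {\<beta>. \<bar>\<beta> \<bullet> x i\<bar> \<le> B}))"
    by (intro closed_Int closed_INT ballI closed_Collect_eq closed_Collect_le continuous_intros)
  also have "{\<beta>. lp_norm \<nu> (snd \<beta>) = 1} \<inter> (\<Inter>i\<in>{1..n}. {\<beta>. \<bar>\<beta> \<bullet> x i\<bar> \<le> B}) = ?S"
    by auto
  finally show "closed ?S" .
qed

lemma fit_value_attains_min:
  fixes x :: "nat \<Rightarrow> real \<times> (real ^ 'd)"
  assumes conj: "\<tau> > 1" "\<nu> > 1" "1 / \<tau> + 1 / \<nu> = 1" and "p > 0"
    and points: "\<And>i. i \<in> {1..n} \<Longrightarrow> fst (x i) = 1"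
    and lam: "\<And>i. i \<in> {1..n} \<Longrightarrow> lam i \<ge> 0"
  obtains \<beta>0 where "lp_norm \<nu> (snd \<beta>0) = 1"
    "\<And>\<beta>. lp_norm \<nu> (snd \<beta>) = 1 \<Longrightarrow> fit_value n lam p x \<beta>0 \<le> fit_value n lam p x \<beta>"
proof -
  \<comment> \<open>The all-ones vector serves as a nonzero vector; normalised, it gives the
    reference point \<open>(0, u)\<close>.\<close>
  define u :: "real ^ 'd" where "u = 1 /\<^sub>R lp_norm \<nu> (1 :: real ^ 'd)"
  have u: "lp_norm \<nu> (snd (0 :: real, u)) = 1"
    using lp_norm_normalise[of \<nu> "1 :: real ^ 'd"] conj by (simp add: u_def vec_eq_iff)
  show thesis
  proof (cases "\<exists>j\<in>{1..n}. lam j > 0")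
    case False
    then have "fit_value n lam p x \<beta> = 0" for \<beta>
      using lam unfolding fit_value_def by (intro sum.neutral) force
    then show ?thesis
      using that[OF u] by simp
  next
    case True
    then obtain j where j: "j \<in> {1..n}" "lam j > 0" ..
    \<comment> \<open>Normalised parameters outside the compact set \<open>S\<close> have value
      above \<open>C\<close>, while the minimum over \<open>S\<close> is at most \<open>C\<close>
      because \<open>(0, u)\<close> lies in \<open>S\<close>.\<close>
    define C where "C = fit_value n lam p x (0, u)"
    define B where "B = (C / lam j) powr (1 / p) + (\<Sum>k=1..n. \<Sum>l=1..n. lp_norm \<tau> (snd (x k) - snd (x l)))"
    define S where "S = {\<beta>. lp_norm \<nu> (snd \<beta>) = 1 \<and> (\<forall>i\<in>{1..n}. \<bar>\<beta> \<bullet> x i\<bar> \<le> B)}"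
    have in_S: "\<beta> \<in> S" if "lp_norm \<nu> (snd \<beta>) = 1" "fit_value n lam p x \<beta> \<le> C" for \<beta>
      using abs_inner_le_of_fit_value_le[OF conj \<open>p > 0\<close> points lam j that] that(1)
      by (auto simp: S_def B_def)
    have "(0, u) \<in> S"
      using in_S[OF u] by (simp add: C_def)
    moreover have "compact S"
      unfolding S_def using conj j points by (intro compact_normalised_bounded[of _ j]) auto
    ultimately obtain \<beta>0 where \<beta>0: "\<beta>0 \<in> S" "\<And>\<beta>. \<beta> \<in> S \<Longrightarrow> fit_value n lam p x \<beta>0 \<le> fit_value n lam p x \<beta>"
      using continuous_attains_inf[OF _ _ continuous_on_fit_value[OF \<open>p > 0\<close>], of S] by blast
    show ?thesis
    proof (rule that)
      show "lp_norm \<nu> (snd \<beta>0) = 1"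
        using \<beta>0(1) by (simp add: S_def)
      fix \<beta> :: "real \<times> (real ^ 'd)" assume "lp_norm \<nu> (snd \<beta>) = 1"
      then show "fit_value n lam p x \<beta>0 \<le> fit_value n lam p x \<beta>"
        using in_S[of \<beta>] \<beta>0(2)[of \<beta>] \<beta>0(2)[OF \<open>(0, u) \<in> S\<close>] by (fold C_def) linarith
    qed
  qed
qed

section \<open>The mixed integer program\<close>

text \<open>Raising to the power s' is strictly monotone on nonnegative reals. This translates the
  polynomial constraint of the program into the rational power of the objective.\<close>

lemma powr_rat_le_iff:
  fixes a z :: real
  assumes "a \<ge> 0" "z \<ge> 0" "0 < r'" "0 < s'"
  shows "a powr (real r' / real s') \<le> z \<longleftrightarrow> a ^ r' \<le> z ^ s'"
proof -
  have "(a powr (real r' / real s')) ^ s' = a ^ r'"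
    using assms by (cases "a = 0") (auto simp: powr_powr zero_power simp flip: powr_realpow)
  then show ?thesis
    using assms power_mono_iff[of "a powr (real r' / real s')" z s'] by simp
qed

text \<open>Moving the exponent to the threshold lets \<open>order_stat_le_iff\<close> be applied to
  the residuals themselves.\<close>

lemma powr_le_iff_le_powr_inverse:
  fixes a t :: real
  assumes "a \<ge> 0" "t \<ge> 0" "p > 0"
  shows "a powr p \<le> t \<longleftrightarrow> a \<le> t powr (1 / p)"
proof
  assume "a powr p \<le> t"
  then have "(a powr p) powr (1 / p) \<le> t powr (1 / p)"
    using assms by (intro powr_mono2) auto
  then show "a \<le> t powr (1 / p)"
    using assms by (simp add: powr_powr)
next
  assume "a \<le> t powr (1 / p)"
  then have "a powr p \<le> (t powr (1 / p)) powr p"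
    using assms by (intro powr_mono2) auto
  then show "a powr p \<le> t"
    using assms by (simp add: powr_powr)
qed

lemma mip_feasible_imp_order_stat_le:
  assumes feas: "mip_feasible \<nu> r' s' n x M (\<beta>, \<epsilon>, z, \<theta>, w)"
    and "0 < r'" "0 < s'" "p = real r' / real s'" and k: "k \<in> {1..n}"
  shows "order_stat n (\<lambda>i. \<bar>\<beta> \<bullet> x i\<bar>) k powr p \<le> \<theta> k"
proof -
  have nonneg: "z i \<ge> 0" "\<theta> i \<ge> 0" if "i \<in> {1..n}" for i
    using feas that by (auto simp: mip_feasible_def)
  have w01: "w i j = 0 \<or> w i j = 1" if "i \<in> {1..n}" "j \<in> {1..n}" for i j
    using feas that by (auto simp: mip_feasible_def)
  have big: "z i \<le> \<theta> j + M * (1 - w i j)" if "i \<in> {1..n}" "j \<in> {1..n}" for i j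
    using feas that by (auto simp: mip_feasible_def)
  have col: "(\<Sum>i=1..n. w i j) = 1" and row: "(\<Sum>i=1..n. w j i) = 1" if "j \<in> {1..n}" for j
    using feas that by (auto simp: mip_feasible_def)
  have step: "\<theta> (j - 1) \<le> \<theta> j" if "j \<in> {2..n}" for j
    using feas that by (auto simp: mip_feasible_def)
  have "p > 0"
    using assms by simp
  have z_ge: "\<bar>\<beta> \<bullet> x i\<bar> powr p \<le> z i" if i: "i \<in> {1..n}" for i
  proof -
    \<comment> \<open>The two linear constraints together bound \<open>\<epsilon> i\<close> below by
      an absolute value, so it is nonnegative and comparing r'-th powers is sound even for even
      r'.\<close>
    have "\<bar>\<beta> \<bullet> x i\<bar> \<le> \<epsilon> i" and pow: "\<epsilon> i ^ r' \<le> z i ^ s'"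
      using feas i by (auto simp: mip_feasible_def abs_le_iff)
    then have "\<bar>\<beta> \<bullet> x i\<bar> ^ r' \<le> z i ^ s'"
      by (intro order_trans[OF power_mono pow]) auto
    then show ?thesis
      using assms nonneg[OF i] by (simp add: powr_rat_le_iff)
  qed
  have theta_mono: "\<theta> j \<le> \<theta> k" if "1 \<le> j" "j \<le> k" for j
  proof -
    \<comment> \<open>The monotonicity constraints stop at index \<open>n\<close>, so this bound is
      carried through the induction.\<close>
    have "k \<le> n \<longrightarrow> \<theta> j \<le> \<theta> k"
      using that(2)
    proof (induction rule: dec_induct)
      case (step m)
      then show ?case
        using \<open>1 \<le> j\<close> \<open>\<And>j. j \<in> {2..n} \<Longrightarrow> \<theta> (j - 1) \<le> \<theta> j\<close>[of "Suc m"] by auto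
    qed simp
    then show ?thesis
      using k by simp
  qed
  \<comment> \<open>A column of zeros would sum to 0. The map \<pi> below picks the row of a 1 in
    each column.\<close>
  have "\<exists>i\<in>{1..n}. w i j = 1" if "j \<in> {1..n}" for j
    using col[OF that] w01[OF _ that] sum.neutral[of "{1..n}" "\<lambda>i. w i j"]
    by (metis zero_neq_one)
  then obtain \<pi> where \<pi>: "\<And>j. j \<in> {1..n} \<Longrightarrow> \<pi> j \<in> {1..n} \<and> w (\<pi> j) j = 1"
    by metis
  have "inj_on \<pi> {1..n}"
  proof (rule inj_onI, rule ccontr)
    fix a b assume ab: "a \<in> {1..n}" "b \<in> {1..n}" "\<pi> a = \<pi> b" "a \<noteq> b"
    \<comment> \<open>If two columns picked the same row, that row would sum to at least 2.\<close>
    have "(\<Sum>j\<in>{a, b}. w (\<pi> a) j) \<le> (\<Sum>j=1..n. w (\<pi> a) j)"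
      using ab \<pi>[OF ab(1)] w01[of "\<pi> a"] by (intro sum_mono2) force+
    then show False
      using ab \<pi>[OF ab(1)] \<pi>[OF ab(2)] row[of "\<pi> a"] by simp
  qed
  then have "inj_on \<pi> {1..k}"
    using k by (auto intro: inj_on_subset)
  then have "k = card (\<pi> ` {1..k})"
    by (simp add: card_image)
  \<comment> \<open>The first \<open>k\<close> columns select \<open>k\<close> distinct points,
    whose residual powers are at most some \<open>\<theta> j\<close> with j \<le> k, hence at most
    \<open>\<theta> k\<close>.\<close>
  also have "\<dots> \<le> card {i \<in> {1..n}. \<bar>\<beta> \<bullet> x i\<bar> \<le> \<theta> k powr (1 / p)}"
  proof (intro card_mono subsetI)
    fix i assume "i \<in> \<pi> ` {1..k}"
    then obtain j where j: "j \<in> {1..n}" "j \<le> k" "i = \<pi> j"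
      using k by auto
    then have "z i \<le> \<theta> j"
      using big[of i j] \<pi>[OF j(1)] by simp
    then have "\<bar>\<beta> \<bullet> x i\<bar> powr p \<le> \<theta> k"
      using z_ge[of i] theta_mono[of j] j \<pi>[OF j(1)] by simp
    then show "i \<in> {i \<in> {1..n}. \<bar>\<beta> \<bullet> x i\<bar> \<le> \<theta> k powr (1 / p)}"
      using \<pi>[OF j(1)] j(3) nonneg[OF k] \<open>p > 0\<close> by (simp add: powr_le_iff_le_powr_inverse)
  qed simp
  finally have "order_stat n (\<lambda>i. \<bar>\<beta> \<bullet> x i\<bar>) k \<le> \<theta> k powr (1 / p)"
    using k by (simp add: order_stat_le_iff)
  then show ?thesis
    using \<open>p > 0\<close> nonneg[OF k] order_stat_nonneg[OF k, of "\<lambda>i. \<bar>\<beta> \<bullet> x i\<bar>"]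
    by (simp add: powr_le_iff_le_powr_inverse)
qed

lemma fit_value_le_mip_objective:
  assumes "mip_feasible \<nu> r' s' n x M (\<beta>, \<epsilon>, z, \<theta>, w)"
    and "0 < r'" "0 < s'" "p = real r' / real s'"
    and "\<And>i. i \<in> {1..n} \<Longrightarrow> lam i \<ge> 0"
  shows "fit_value n lam p x \<beta> \<le> mip_objective n lam (\<beta>, \<epsilon>, z, \<theta>, w)"
  unfolding fit_value_def mip_objective_def prod.case
  by (intro sum_mono mult_left_mono mip_feasible_imp_order_stat_le[OF assms(1-4)] assms(5))

text \<open>For the permutation matrix of \<sigma>, the big-M constraint binds at
  \<open>j = \<sigma> i\<close> and is relaxed by \<open>M\<close> elsewhere; \<open>le\<close> and
  \<open>leM\<close> are these two cases. \<theta> stays arbitrary to serve two different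
  choices.\<close>

lemma mip_feasible_permutation:
  assumes "0 < r'" "0 < s'" "p = real r' / real s'" "lp_norm \<nu> (snd \<beta>) = 1"
    and \<sigma>: "bij_betw \<sigma> {1..n} {1..n}"
    and \<theta>: "\<And>j. j \<in> {1..n} \<Longrightarrow> \<theta> j \<ge> 0" "\<And>j. j \<in> {2..n} \<Longrightarrow> \<theta> (j - 1) \<le> \<theta> j"
    and le: "\<And>i. i \<in> {1..n} \<Longrightarrow> \<bar>\<beta> \<bullet> x i\<bar> powr p \<le> \<theta> (\<sigma> i)"
    and leM: "\<And>i j. i \<in> {1..n} \<Longrightarrow> j \<in> {1..n} \<Longrightarrow> \<bar>\<beta> \<bullet> x i\<bar> powr p \<le> \<theta> j + M"
  shows "mip_feasible \<nu> r' s' n x M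
    (\<beta>, \<lambda>i. \<bar>\<beta> \<bullet> x i\<bar>, \<lambda>i. \<bar>\<beta> \<bullet> x i\<bar> powr p, \<theta>, \<lambda>i j. if j = \<sigma> i then 1 else 0)"
proof -
  have "(\<Sum>i=1..n. if j = \<sigma> i then 1 else 0) = (1 :: real)" if "j \<in> {1..n}" for j
    using sum.reindex_bij_betw[OF \<sigma>, of "\<lambda>i. if j = i then 1 else 0"] that by simp
  moreover have "(\<Sum>j=1..n. if j = \<sigma> i then 1 else 0) = (1 :: real)" if "i \<in> {1..n}" for i
    using bij_betwE[OF \<sigma>] that by simp
  moreover have "\<bar>\<beta> \<bullet> x i\<bar> ^ r' \<le> (\<bar>\<beta> \<bullet> x i\<bar> powr p) ^ s'" for i
    using assms(1-3) powr_rat_le_iff[of "\<bar>\<beta> \<bullet> x i\<bar>" "\<bar>\<beta> \<bullet> x i\<bar> powr p" r' s'] by simp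
  ultimately show ?thesis
    using assms by (auto simp: mip_feasible_def)
qed

text \<open>If all weights vanish, the optimal \<open>\<beta>\<close> are unbounded while \<open>M\<close> is fixed; a constant \<open>\<theta>\<close> is
  then feasible and costs nothing.\<close>

lemma mip_attains_fit_value:
  assumes rs: "0 < r'" "0 < s'" "p = real r' / real s'" and unit: "lp_norm \<nu> (snd \<beta>) = 1" and "M \<ge> 0"
    and "(\<forall>k\<in>{1..n}. lam k = 0) \<or> (\<forall>i\<in>{1..n}. \<bar>\<beta> \<bullet> x i\<bar> powr p \<le> M)"
  obtains \<epsilon> z \<theta> w where "mip_feasible \<nu> r' s' n x M (\<beta>, \<epsilon>, z, \<theta>, w)"
    "mip_objective n lam (\<beta>, \<epsilon>, z, \<theta>, w) = fit_value n lam p x \<beta>"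
  using assms(6)
proof
  assume lam: "\<forall>k\<in>{1..n}. lam k = 0"
  \<comment> \<open>The sum dominates every single power, and a constant \<theta> is monotone, so
    even the identity assignment works.\<close>
  define c where "c = (\<Sum>i=1..n. \<bar>\<beta> \<bullet> x i\<bar> powr p)"
  have "\<bar>\<beta> \<bullet> x i\<bar> powr p \<le> c" if "i \<in> {1..n}" for i
    unfolding c_def using that by (intro member_le_sum) auto
  moreover have "c \<ge> 0"
    unfolding c_def by (intro sum_nonneg) simp
  ultimately have "mip_feasible \<nu> r' s' n x M
      (\<beta>, \<lambda>i. \<bar>\<beta> \<bullet> x i\<bar>, \<lambda>i. \<bar>\<beta> \<bullet> x i\<bar> powr p, \<lambda>_. c, \<lambda>i j. if j = id i then 1 else 0)"
    using \<open>M \<ge> 0\<close> by (intro mip_feasible_permutation[OF rs unit bij_betw_id]) (auto intro: add_increasing2)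
  then show thesis
    using lam by (intro that) (auto simp: mip_objective_def fit_value_def)
next
  assume bound: "\<forall>i\<in>{1..n}. \<bar>\<beta> \<bullet> x i\<bar> powr p \<le> M"
  define \<theta> where "\<theta> = (\<lambda>k. order_stat n (\<lambda>i. \<bar>\<beta> \<bullet> x i\<bar>) k powr p)"
  \<comment> \<open>Each point is assigned to its rank, so its power equals
    \<open>\<theta> (\<sigma> i)\<close>; elsewhere \<open>M\<close> alone dominates the
    power.\<close>
  obtain \<sigma> where \<sigma>: "bij_betw \<sigma> {1..n} {1..n}"
    "\<And>i. i \<in> {1..n} \<Longrightarrow> order_stat n (\<lambda>i. \<bar>\<beta> \<bullet> x i\<bar>) (\<sigma> i) = \<bar>\<beta> \<bullet> x i\<bar>"
    using order_stat_permutation[of n "\<lambda>i. \<bar>\<beta> \<bullet> x i\<bar>"] by metis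
  have "\<theta> (j - 1) \<le> \<theta> j" if "j \<in> {2..n}" for j
    unfolding \<theta>_def using that rs
    by (intro powr_mono2 order_stat_mono order_stat_nonneg) auto
  then have "mip_feasible \<nu> r' s' n x M
      (\<beta>, \<lambda>i. \<bar>\<beta> \<bullet> x i\<bar>, \<lambda>i. \<bar>\<beta> \<bullet> x i\<bar> powr p, \<theta>, \<lambda>i j. if j = \<sigma> i then 1 else 0)"
    using bound \<sigma>(2)
    by (intro mip_feasible_permutation[OF rs unit \<sigma>(1)]) (auto simp: \<theta>_def intro: add_increasing)
  then show thesis
    by (intro that) (auto simp: mip_objective_def fit_value_def \<theta>_def)
qed

section \<open>Equality of the optimal values and transfer of minimisers for all large M\<close>

theorem theorem23:
  fixes x :: "nat \<Rightarrow> real \<times> (real ^ 'd)" and lam :: "nat \<Rightarrow> real"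
    and n r s r' s' :: nat and \<tau> \<nu> p :: real
  assumes points: "\<And>i. i \<in> {1..n} \<Longrightarrow> fst (x i) = 1"
    and lam_nonneg: "\<And>i. i \<in> {1..n} \<Longrightarrow> lam i \<ge> 0"
    and tau: "\<tau> = real r / real s" "0 < s" "s < r" "gcd r s = 1"
    and nu: "1 / \<tau> + 1 / \<nu> = 1"
    and p: "p = real r' / real s'" "0 < r'" "0 < s'"
  shows "\<forall>\<^sub>F M in at_top.
    (\<exists>\<beta>. is_arg_min (fit_objective \<tau> p n lam x) fit_feasible \<beta>) \<and>
    (\<exists>v. is_arg_min (mip_objective n lam) (mip_feasible \<nu> r' s' n x M) v) \<and>
    (\<forall>\<beta> v. is_arg_min (fit_objective \<tau> p n lam x) fit_feasible \<beta> \<longrightarrow>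
       is_arg_min (mip_objective n lam) (mip_feasible \<nu> r' s' n x M) v \<longrightarrow>
       fit_objective \<tau> p n lam x \<beta> = mip_objective n lam v) \<and>
    (\<forall>\<beta> \<epsilon> z \<theta> w.
       is_arg_min (mip_objective n lam) (mip_feasible \<nu> r' s' n x M) (\<beta>, \<epsilon>, z, \<theta>, w) \<longrightarrow>
       is_arg_min (fit_objective \<tau> p n lam x) fit_feasible \<beta>) \<and>
    (\<forall>\<beta>. is_arg_min (fit_objective \<tau> p n lam x) fit_feasible \<beta> \<longrightarrow>
       (\<exists>\<epsilon> z \<theta> w. is_arg_min (mip_objective n lam) (mip_feasible \<nu> r' s' n x M)
          (\<beta> /\<^sub>R lp_norm \<nu> (snd \<beta>), \<epsilon>, z, \<theta>, w)))"
proof -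
  let ?fit = "fit_objective \<tau> p n lam x" and ?val = "fit_value n lam p x"
    and ?unit = "\<lambda>\<beta> :: real \<times> (real ^ 'd). lp_norm \<nu> (snd \<beta>) = 1"
    and ?nrm = "\<lambda>\<beta> :: real \<times> (real ^ 'd). \<beta> /\<^sub>R lp_norm \<nu> (snd \<beta>)"
  have "\<tau> > 1"
    using tau by simp
  have "1 / \<tau> < 1" "1 / \<tau> > 0"
    using \<open>\<tau> > 1\<close> by auto
  \<comment> \<open>Positivity also excludes \<nu> = 0, where 1 / \<nu> would be 0.\<close>
  then have "0 < 1 / \<nu>" "1 / \<nu> < 1"
    using nu by linarith+
  then have "\<nu> > 1"
    by (simp add: field_simps split: if_splits)
  have "p > 0"
    using p by simp
  note conj = \<open>\<tau> > 1\<close> \<open>\<nu> > 1\<close> nu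
  have unit: "?unit (?nrm \<beta>)" if "fit_feasible \<beta>" for \<beta>
    using lp_norm_normalise[of \<nu> "snd \<beta>"] that \<open>\<nu> > 1\<close> by (simp add: fit_feasible_def)
  have fit_eq: "?fit \<beta> = ?val (?nrm \<beta>)" if "fit_feasible \<beta>" for \<beta>
    using fit_objective_eq_fit_value[OF conj _ points] that by (simp add: fit_feasible_def)
  have feasible: "fit_feasible \<beta>" if "?unit \<beta>" for \<beta>
    using that by (auto simp: fit_feasible_def)
  obtain \<beta>0 where \<beta>0: "?unit \<beta>0" "\<And>\<beta>. ?unit \<beta> \<Longrightarrow> ?val \<beta>0 \<le> ?val \<beta>"
    using fit_value_attains_min[where lam = lam and x = x, OF conj \<open>p > 0\<close> points lam_nonneg] by blast
  define V where "V = ?val \<beta>0"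
  have fit_min: "is_arg_min ?fit fit_feasible \<beta> \<longleftrightarrow> fit_feasible \<beta> \<and> ?fit \<beta> = V" for \<beta>
  proof -
    have "V \<le> ?fit \<gamma>" if "fit_feasible \<gamma>" for \<gamma>
      using \<beta>0(2)[OF unit[OF that]] fit_eq[OF that] by (simp add: V_def)
    moreover have "?fit \<beta>0 = V"
      using fit_eq[OF feasible[OF \<beta>0(1)]] \<beta>0(1) by (simp add: V_def)
    ultimately show ?thesis
      using feasible[OF \<beta>0(1)] unfolding is_arg_min_linorder by (metis order_antisym)
  qed
  \<comment> \<open>One constant must serve all normalised minimisers at once; the residual bound at
    level \<open>V\<close> does not depend on \<beta>.\<close>
  obtain M0 where M0: "(\<forall>k\<in>{1..n}. lam k = 0) \<or> (\<forall>i\<in>{1..n}. \<bar>\<beta> \<bullet> x i\<bar> powr p \<le> M0)"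
    if "?unit \<beta>" "?val \<beta> = V" for \<beta>
  proof (cases "\<exists>j\<in>{1..n}. lam j > 0")
    case False
    then show ?thesis
      using that lam_nonneg by (metis less_eq_real_def)
  next
    case True
    then obtain j where j: "j \<in> {1..n}" "lam j > 0" ..
    define B where "B = (V / lam j) powr (1 / p) + (\<Sum>k=1..n. \<Sum>l=1..n. lp_norm \<tau> (snd (x k) - snd (x l)))"
    have "\<bar>\<beta> \<bullet> x i\<bar> powr p \<le> B powr p" if "?unit \<beta>" "?val \<beta> = V" "i \<in> {1..n}" for \<beta> i
    proof (intro powr_mono2)
      show "\<bar>\<beta> \<bullet> x i\<bar> \<le> B"
        unfolding B_def using that
        by (intro abs_inner_le_of_fit_value_le[where lam = lam and x = x, OF conj \<open>p > 0\<close> points lam_nonneg j])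
          auto
    qed (use \<open>p > 0\<close> in auto)
    then show ?thesis
      using that by blast
  qed
  \<comment> \<open>\<open>M0\<close> is arbitrary when all weights vanish, so nonnegativity of
    \<open>M\<close> is demanded separately.\<close>
  show ?thesis
    using eventually_ge_at_top[of "max 0 M0"]
  proof eventually_elim
    case (elim M)
    let ?obj = "mip_objective n lam :: 'd mip_vars \<Rightarrow> real" and ?feas = "mip_feasible \<nu> r' s' n x M"
    have lower: "V \<le> ?val \<beta>" "?val \<beta> \<le> ?obj (\<beta>, \<epsilon>, z, \<theta>, w)" "?unit \<beta>"
      if "?feas (\<beta>, \<epsilon>, z, \<theta>, w)" for \<beta> \<epsilon> z \<theta> w
    proof -
      show "?unit \<beta>"
        using that by (simp add: mip_feasible_def)
      then show "V \<le> ?val \<beta>"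
        unfolding V_def by (rule \<beta>0(2))
      show "?val \<beta> \<le> ?obj (\<beta>, \<epsilon>, z, \<theta>, w)"
        by (rule fit_value_le_mip_objective[OF that p(2,3,1) lam_nonneg])
    qed
    have attain: "\<exists>\<epsilon> z \<theta> w. ?feas (\<beta>, \<epsilon>, z, \<theta>, w) \<and> ?obj (\<beta>, \<epsilon>, z, \<theta>, w) = V"
      if "?unit \<beta>" "?val \<beta> = V" for \<beta>
    proof -
      have "(\<forall>k\<in>{1..n}. lam k = 0) \<or> (\<forall>i\<in>{1..n}. \<bar>\<beta> \<bullet> x i\<bar> powr p \<le> M)"
        using M0[OF that] elim by fastforce
      then show ?thesis
        using mip_attains_fit_value[OF p(2,3,1) that(1), of M n lam x] elim that(2)
        by (metis max.bounded_iff)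
    qed
    \<comment> \<open>Both sets of minimisers are now the feasible points of the common value
      \<open>V\<close>, which reduces the remaining claims to comparing values.\<close>
    have mip_min: "is_arg_min ?obj ?feas v \<longleftrightarrow> ?feas v \<and> ?obj v = V" for v
    proof -
      have "V \<le> ?obj u" if "?feas u" for u
        using that lower by (cases u) (meson order_trans)
      then show ?thesis
        using attain[OF \<beta>0(1)] unfolding is_arg_min_linorder by (metis V_def order_antisym)
    qed
    have "is_arg_min ?fit fit_feasible \<beta>" if "is_arg_min ?obj ?feas (\<beta>, \<epsilon>, z, \<theta>, w)" for \<beta> \<epsilon> z \<theta> w
    proof -
      \<comment> \<open>The value of \<beta> is squeezed between \<open>V\<close> and the objective
        of the program, which is \<open>V\<close> here.\<close>
      have "?unit \<beta>" "?val \<beta> = V"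
        using that lower[of \<beta> \<epsilon> z \<theta> w] unfolding mip_min by auto
      then show ?thesis
        using feasible[of \<beta>] fit_eq[of \<beta>] unfolding fit_min by simp
    qed
    moreover have "\<exists>\<epsilon> z \<theta> w. is_arg_min ?obj ?feas (?nrm \<beta>, \<epsilon>, z, \<theta>, w)"
      if "is_arg_min ?fit fit_feasible \<beta>" for \<beta>
      using that attain[of "?nrm \<beta>"] unit[of \<beta>] fit_eq[of \<beta>] unfolding fit_min mip_min by simp
    moreover have "\<exists>\<beta>. is_arg_min ?fit fit_feasible \<beta>"
      using \<beta>0(1) feasible fit_eq[OF feasible[OF \<beta>0(1)]] unfolding fit_min
      by (intro exI[of _ \<beta>0]) (simp add: V_def)
    moreover have "?fit \<beta> = ?obj v"
      if "is_arg_min ?fit fit_feasible \<beta>" "is_arg_min ?obj ?feas v" for \<beta> v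
      using that unfolding fit_min mip_min by simp
    ultimately show ?case
      by blast
  qed
qed

end
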